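(* The varieties $\mathbb{RDMP}$ (regular De Morgan p-algebras) and $\mathbb{RDMH}$ (regular De Morgan Heyting algebras) are term-equivalent to each other. More explicitly: (a) For $\mathbf A = \langle A, \lor, \land, {}^*, {}', 0, 1 \rangle \in \mathbb{RDMP}$, let $\mathbf{A}^{dmh} := \langle A, \lor, \land, \to, {}', 0, 1 \rangle$, where $x \to y := (x^{*} \lor y^{**})^{**} \land [(x \lor x^{*})'{}^{*}{}' \lor x^{*} \lor y \lor y^{*}]$. Then $\mathbf{A}^{dmh} \in \mathbb{RDMH}$. (b) For $\mathbf A = \langle A, \lor, \land, \to, {}', 0, 1 \rangle \in \mathbb{RDMH}$, let $\mathbf{A}^{dmp} := \langle A, \lor, \land, {}^*, {}', 0, 1 \rangle$, where $x^* := x \to 0$. Then $\mathbf{A}^{dmp} \in \mathbb{RDMP}$. (c) If $\mathbf A \in \mathbb{RDMP}$, then $(\mathbf{A}^{dmh})^{dmp} = \mathbf A$. (d) If $\mathbf A \in \mathbb{RDMH}$, then $(\mathbf{A}^{dmp})^{dmh} = \mathbf A$.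
   Context: A De Morgan algebra is a bounded distributive lattice with a unary operation ${}'$ satisfying $x''\approx x$, $(x\vee y)'\approx x'\wedge y'$, $(x\wedge y)'\approx x'\vee y'$, $0'\approx1$, $1'\approx0$. Write $x'{}^*{}'$ for $((x')^* )'$. $\mathbb{RDMP}$: algebras $\langle A,\vee,\wedge,{}^*,{}',0,1\rangle$ such that $\langle A,\vee,\wedge,{}',0,1\rangle$ is a De Morgan algebra, ${}^*$ is the pseudocomplement ($x^*$ is the largest $z$ with $x\wedge z=0$), and the regularity identity $(x\wedge x'{}^*{}')\vee(y\vee y^* )\approx y\vee y^*$ holds. $\mathbb{RDMH}$: algebras $\langle A,\vee,\wedge,\to,{}',0,1\rangle$ such that $\langle A,\vee,\wedge,{}',0,1\rangle$ is a De Morgan algebra, $\langle A,\vee,\wedge,\to,0,1\rangle$ is a Heyting algebra, and the same regularity identity holds with $x^*:=x\to0$. Term-equivalence here means precisely the content of (a)-(d). *)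

theory Defs
  imports "HOL-Algebra.Congruence"
begin

text \<open>
  An algebra consists of a carrier set and operations on that set.  All operations are required
  to be extensional (\<open>\<rightarrow>\<^sub>E\<close>), that is, they carry no information outside the carrier; hence
  equality of records is equality of algebras.
\<close>

record 'a bounded_lat = "'a partial_object" +
  join :: "'a \<Rightarrow> 'a \<Rightarrow> 'a"  (infixl \<open>\<squnion>\<index>\<close> 65)
  meet :: "'a \<Rightarrow> 'a \<Rightarrow> 'a"  (infixl \<open>\<sqinter>\<index>\<close> 70)
  zero :: 'a  (\<open>\<zero>\<index>\<close>)
  one :: 'a  (\<open>\<one>\<index>\<close>)

record 'a dm_algebra = "'a bounded_lat" +
  neg :: "'a \<Rightarrow> 'a"  (\<open>_\<^sup>\<prime>\<index>\<close> [1000] 1000)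

record 'a dmp_algebra = "'a dm_algebra" +
  pcomp :: "'a \<Rightarrow> 'a"  (\<open>_\<^sup>\<star>\<index>\<close> [1000] 1000)

record 'a dmh_algebra = "'a dm_algebra" +
  imp :: "'a \<Rightarrow> 'a \<Rightarrow> 'a"  (infixr \<open>\<rightarrow>\<index>\<close> 60)

definition lat_le :: "('a, 'm) bounded_lat_scheme \<Rightarrow> 'a \<Rightarrow> 'a \<Rightarrow> bool"  (infixl \<open>\<preceq>\<index>\<close> 50)
  where "x \<preceq>\<^bsub>L\<^esub> y \<longleftrightarrow> x \<sqinter>\<^bsub>L\<^esub> y = x"

locale bounded_distrib_lattice =
  fixes L :: "('a, 'm) bounded_lat_scheme" (structure)
  assumes join_type: "join L \<in> carrier L \<rightarrow>\<^sub>E carrier L \<rightarrow>\<^sub>E carrier L"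
    and meet_type: "meet L \<in> carrier L \<rightarrow>\<^sub>E carrier L \<rightarrow>\<^sub>E carrier L"
    and zero_closed: "\<zero> \<in> carrier L"
    and one_closed: "\<one> \<in> carrier L"
    and join_assoc: "\<lbrakk>x \<in> carrier L; y \<in> carrier L; z \<in> carrier L\<rbrakk> \<Longrightarrow> (x \<squnion> y) \<squnion> z = x \<squnion> (y \<squnion> z)"
    and meet_assoc: "\<lbrakk>x \<in> carrier L; y \<in> carrier L; z \<in> carrier L\<rbrakk> \<Longrightarrow> (x \<sqinter> y) \<sqinter> z = x \<sqinter> (y \<sqinter> z)"
    and join_comm: "\<lbrakk>x \<in> carrier L; y \<in> carrier L\<rbrakk> \<Longrightarrow> x \<squnion> y = y \<squnion> x"
    and meet_comm: "\<lbrakk>x \<in> carrier L; y \<in> carrier L\<rbrakk> \<Longrightarrow> x \<sqinter> y = y \<sqinter> x"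
    and join_absorb: "\<lbrakk>x \<in> carrier L; y \<in> carrier L\<rbrakk> \<Longrightarrow> x \<squnion> (x \<sqinter> y) = x"
    and meet_absorb: "\<lbrakk>x \<in> carrier L; y \<in> carrier L\<rbrakk> \<Longrightarrow> x \<sqinter> (x \<squnion> y) = x"
    and distrib: "\<lbrakk>x \<in> carrier L; y \<in> carrier L; z \<in> carrier L\<rbrakk>
      \<Longrightarrow> x \<sqinter> (y \<squnion> z) = (x \<sqinter> y) \<squnion> (x \<sqinter> z)"
    and join_zero: "x \<in> carrier L \<Longrightarrow> x \<squnion> \<zero> = x"
    and meet_one: "x \<in> carrier L \<Longrightarrow> x \<sqinter> \<one> = x"

locale de_morgan_algebra = bounded_distrib_lattice L
  for L :: "('a, 'm) dm_algebra_scheme" (structure) +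
  assumes neg_type: "neg L \<in> carrier L \<rightarrow>\<^sub>E carrier L"
    and neg_neg: "x \<in> carrier L \<Longrightarrow> x\<^sup>\<prime>\<^sup>\<prime> = x"
    and neg_join: "\<lbrakk>x \<in> carrier L; y \<in> carrier L\<rbrakk> \<Longrightarrow> (x \<squnion> y)\<^sup>\<prime> = x\<^sup>\<prime> \<sqinter> y\<^sup>\<prime>"
    and neg_meet: "\<lbrakk>x \<in> carrier L; y \<in> carrier L\<rbrakk> \<Longrightarrow> (x \<sqinter> y)\<^sup>\<prime> = x\<^sup>\<prime> \<squnion> y\<^sup>\<prime>"
    and neg_zero: "\<zero>\<^sup>\<prime> = \<one>"
    and neg_one: "\<one>\<^sup>\<prime> = \<zero>"

locale pseudocomplemented_lattice = bounded_distrib_lattice L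
  for L :: "('a, 'm) bounded_lat_scheme" (structure) +
  fixes star :: "'a \<Rightarrow> 'a"
  assumes star_type: "star \<in> carrier L \<rightarrow>\<^sub>E carrier L"
    and meet_star: "x \<in> carrier L \<Longrightarrow> x \<sqinter> star x = \<zero>"
    and star_greatest: "\<lbrakk>x \<in> carrier L; z \<in> carrier L; x \<sqinter> z = \<zero>\<rbrakk> \<Longrightarrow> z \<preceq> star x"

locale heyting_algebra = bounded_distrib_lattice L
  for L :: "('a, 'm) bounded_lat_scheme" (structure) +
  fixes arrow :: "'a \<Rightarrow> 'a \<Rightarrow> 'a"
  assumes arrow_type: "arrow \<in> carrier L \<rightarrow>\<^sub>E carrier L \<rightarrow>\<^sub>E carrier L"
    and residuation: "\<lbrakk>x \<in> carrier L; y \<in> carrier L; z \<in> carrier L\<rbrakk>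
      \<Longrightarrow> x \<sqinter> z \<preceq> y \<longleftrightarrow> z \<preceq> arrow x y"

definition regular :: "('a, 'm) dm_algebra_scheme \<Rightarrow> ('a \<Rightarrow> 'a) \<Rightarrow> bool"
  where "regular L star \<longleftrightarrow> (\<forall>x \<in> carrier L. \<forall>y \<in> carrier L.
    (x \<sqinter>\<^bsub>L\<^esub> (star (x\<^sup>\<prime>\<^bsub>L\<^esub>))\<^sup>\<prime>\<^bsub>L\<^esub>) \<squnion>\<^bsub>L\<^esub> (y \<squnion>\<^bsub>L\<^esub> star y) = y \<squnion>\<^bsub>L\<^esub> star y)"

definition RDMP :: "'a dmp_algebra set"
  where "RDMP = {A. de_morgan_algebra A \<and> pseudocomplemented_lattice A (pcomp A) \<and> regular A (pcomp A)}"

definition RDMH :: "'a dmh_algebra set"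
  where "RDMH = {A. de_morgan_algebra A \<and> heyting_algebra A (imp A)
    \<and> regular A (\<lambda>x. x \<rightarrow>\<^bsub>A\<^esub> \<zero>\<^bsub>A\<^esub>)}"

context
  fixes A :: "'a dmp_algebra" (structure)
begin

definition dmh_imp :: "'a \<Rightarrow> 'a \<Rightarrow> 'a"
  where "dmh_imp x y =
    (x\<^sup>\<star> \<squnion> y\<^sup>\<star>\<^sup>\<star>)\<^sup>\<star>\<^sup>\<star> \<sqinter> ((x \<squnion> x\<^sup>\<star>)\<^sup>\<prime>\<^sup>\<star>\<^sup>\<prime> \<squnion> x\<^sup>\<star> \<squnion> y \<squnion> y\<^sup>\<star>)"

definition dmh :: "'a dmh_algebra"
  where "dmh =
    \<lparr>carrier = carrier A, join = join A, meet = meet A, zero = \<zero>, one = \<one>, neg = neg A,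
     imp = (\<lambda>x \<in> carrier A. \<lambda>y \<in> carrier A. dmh_imp x y)\<rparr>"

end

definition dmp :: "'a dmh_algebra \<Rightarrow> 'a dmp_algebra"
  where "dmp A =
    \<lparr>carrier = carrier A, join = join A, meet = meet A, zero = \<zero>\<^bsub>A\<^esub>, one = \<one>\<^bsub>A\<^esub>, neg = neg A,
     pcomp = (\<lambda>x \<in> carrier A. x \<rightarrow>\<^bsub>A\<^esub> \<zero>\<^bsub>A\<^esub>)\<rparr>"

end

theory Submission
  imports Defs
begin

text \<open>
  Write \<open>x\<^sup>+\<close> for the dual pseudocomplement \<open>x'*'\<close>, put \<open>w = x \<squnion> x\<^sup>*\<close> and let
  \<open>a = (x\<^sup>* \<squnion> y\<^sup>*\<^sup>*)\<^sup>*\<^sup>*\<close>, \<open>b = w\<^sup>+ \<squnion> x\<^sup>* \<squnion> y \<squnion> y\<^sup>*\<close>.  Then \<open>a \<sqinter> b\<close> is the relative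
  pseudocomplement of \<open>x\<close> with respect to \<open>y\<close>.  If \<open>x \<sqinter> z \<preceq> y\<close>, then \<open>z\<close> is disjoint from
  \<open>(x\<^sup>* \<squnion> y\<^sup>*\<^sup>*)\<^sup>*\<close>, so \<open>z \<preceq> a\<close>; and \<open>z \<preceq> b\<close> follows by splitting \<open>z\<close> along \<open>w\<^sup>+ \<squnion> w = 1\<close>.
  Conversely, \<open>x \<sqinter> a \<sqinter> y\<^sup>* = 0\<close>, hence \<open>x \<sqinter> a \<sqinter> (y \<squnion> y\<^sup>*) \<preceq> y\<close>, and \<open>x \<sqinter> b \<preceq> y \<squnion> y\<^sup>*\<close> because
  regularity gives \<open>w \<sqinter> w\<^sup>+ \<preceq> y \<squnion> y\<^sup>*\<close>.  The two translations are mutually inverse because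
  pseudocomplements and relative pseudocomplements are unique.
\<close>

section \<open>Order in bounded distributive lattices\<close>

context bounded_distrib_lattice
begin

lemma join_closed [simp]: "\<lbrakk>x \<in> carrier L; y \<in> carrier L\<rbrakk> \<Longrightarrow> x \<squnion> y \<in> carrier L"
  using join_type by (meson PiE_mem)

lemma meet_closed [simp]: "\<lbrakk>x \<in> carrier L; y \<in> carrier L\<rbrakk> \<Longrightarrow> x \<sqinter> y \<in> carrier L"
  using meet_type by (meson PiE_mem)

lemmas bounds_closed [simp] = zero_closed one_closed

lemma le_iff_join: "\<lbrakk>x \<in> carrier L; y \<in> carrier L\<rbrakk> \<Longrightarrow> x \<preceq> y \<longleftrightarrow> x \<squnion> y = y"
  unfolding lat_le_def by (metis join_absorb join_comm meet_absorb meet_comm)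

lemma le_refl: "x \<in> carrier L \<Longrightarrow> x \<preceq> x"
  unfolding lat_le_def by (metis join_absorb meet_absorb meet_closed)

lemma le_antisym: "\<lbrakk>x \<in> carrier L; y \<in> carrier L; x \<preceq> y; y \<preceq> x\<rbrakk> \<Longrightarrow> x = y"
  unfolding lat_le_def by (metis meet_comm)

lemma le_trans: "\<lbrakk>x \<in> carrier L; y \<in> carrier L; z \<in> carrier L; x \<preceq> y; y \<preceq> z\<rbrakk> \<Longrightarrow> x \<preceq> z"
  unfolding lat_le_def by (metis meet_assoc)

lemma meet_le1: "\<lbrakk>x \<in> carrier L; y \<in> carrier L\<rbrakk> \<Longrightarrow> x \<sqinter> y \<preceq> x"
  by (metis join_absorb join_comm le_iff_join meet_closed)

lemma meet_le2: "\<lbrakk>x \<in> carrier L; y \<in> carrier L\<rbrakk> \<Longrightarrow> x \<sqinter> y \<preceq> y"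
  by (metis meet_comm meet_le1)

lemma le_meet_iff:
  assumes "x \<in> carrier L" "y \<in> carrier L" "z \<in> carrier L"
  shows "z \<preceq> x \<sqinter> y \<longleftrightarrow> z \<preceq> x \<and> z \<preceq> y"
proof
  assume "z \<preceq> x \<sqinter> y"
  with assms show "z \<preceq> x \<and> z \<preceq> y"
    by (meson le_trans meet_closed meet_le1 meet_le2)
next
  assume "z \<preceq> x \<and> z \<preceq> y"
  with assms show "z \<preceq> x \<sqinter> y"
    unfolding lat_le_def by (metis meet_assoc)
qed

lemma meet_mono_right:
  assumes "x \<in> carrier L" "y \<in> carrier L" "z \<in> carrier L" "y \<preceq> z"
  shows "x \<sqinter> y \<preceq> x \<sqinter> z"
  using assms le_trans[OF _ _ _ meet_le2[of x y], of z] by (simp add: le_meet_iff meet_le1)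

lemma join_ge1: "\<lbrakk>x \<in> carrier L; y \<in> carrier L\<rbrakk> \<Longrightarrow> x \<preceq> x \<squnion> y"
  by (simp add: lat_le_def meet_absorb)

lemma join_ge2: "\<lbrakk>x \<in> carrier L; y \<in> carrier L\<rbrakk> \<Longrightarrow> y \<preceq> x \<squnion> y"
  by (metis join_comm join_ge1)

lemma le_joinI1:
  "\<lbrakk>x \<preceq> y; x \<in> carrier L; y \<in> carrier L; z \<in> carrier L\<rbrakk> \<Longrightarrow> x \<preceq> y \<squnion> z"
  by (meson join_closed join_ge1 le_trans)

lemma le_joinI2:
  "\<lbrakk>x \<preceq> z; x \<in> carrier L; y \<in> carrier L; z \<in> carrier L\<rbrakk> \<Longrightarrow> x \<preceq> y \<squnion> z"
  by (meson join_closed join_ge2 le_trans)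

lemma join_le_iff:
  assumes "x \<in> carrier L" "y \<in> carrier L" "z \<in> carrier L"
  shows "x \<squnion> y \<preceq> z \<longleftrightarrow> x \<preceq> z \<and> y \<preceq> z"
proof
  assume "x \<squnion> y \<preceq> z"
  with assms show "x \<preceq> z \<and> y \<preceq> z"
    by (meson join_closed join_ge1 join_ge2 le_trans)
next
  assume "x \<preceq> z \<and> y \<preceq> z"
  with assms show "x \<squnion> y \<preceq> z"
    by (simp add: le_iff_join join_assoc)
qed

lemma zero_le: "x \<in> carrier L \<Longrightarrow> \<zero> \<preceq> x"
  by (metis join_comm join_zero le_iff_join zero_closed)

lemma le_zero_iff: "x \<in> carrier L \<Longrightarrow> x \<preceq> \<zero> \<longleftrightarrow> x = \<zero>"
  by (metis le_antisym le_refl zero_closed zero_le)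

text \<open>Pseudocomplement and implication are specified by the elements below them, so equations
  between them are proved in this form.\<close>

lemma eq_if_same_lower:
  assumes "x \<in> carrier L" "y \<in> carrier L" "\<And>z. z \<in> carrier L \<Longrightarrow> z \<preceq> x \<longleftrightarrow> z \<preceq> y"
  shows "x = y"
  using assms le_antisym le_refl by blast

end

section \<open>Pseudocomplements and the residual criterion\<close>

context pseudocomplemented_lattice
begin

lemma star_closed [simp]: "x \<in> carrier L \<Longrightarrow> star x \<in> carrier L"
  using star_type by (meson PiE_mem)

lemma le_star_iff:
  assumes "x \<in> carrier L" "z \<in> carrier L"
  shows "z \<preceq> star x \<longleftrightarrow> x \<sqinter> z = \<zero>"
proof
  assume "z \<preceq> star x"
  with assms have "x \<sqinter> z \<preceq> x \<sqinter> star x"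
    by (simp add: meet_mono_right)
  with assms show "x \<sqinter> z = \<zero>"
    by (simp add: meet_star le_zero_iff)
qed (simp add: assms star_greatest)

text \<open>Disjointness is symmetric, so \<open>star\<close> forms an antitone Galois connection
  with itself. This yields antitonicity, \<open>star_join\<close> and
  \<open>star_star_star\<close>.\<close>

lemma le_star_commute:
  "\<lbrakk>x \<in> carrier L; z \<in> carrier L\<rbrakk> \<Longrightarrow> z \<preceq> star x \<longleftrightarrow> x \<preceq> star z"
  by (simp add: le_star_iff meet_comm)

lemma le_star_star: "x \<in> carrier L \<Longrightarrow> x \<preceq> star (star x)"
  by (simp add: le_star_commute[of "star x" x] le_refl)

lemma star_antimono:
  assumes "x \<in> carrier L" "y \<in> carrier L" "x \<preceq> y"
  shows "star y \<preceq> star x"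
proof -
  have "x \<preceq> star (star y)"
    using assms le_star_star le_trans[of x y "star (star y)"] by simp
  then show ?thesis
    using assms le_star_commute[of x "star y"] by simp
qed

lemma star_join:
  assumes "x \<in> carrier L" "y \<in> carrier L"
  shows "star (x \<squnion> y) = star x \<sqinter> star y"
proof (rule eq_if_same_lower)
  fix z assume "z \<in> carrier L"
  with assms show "z \<preceq> star (x \<squnion> y) \<longleftrightarrow> z \<preceq> star x \<sqinter> star y"
    by (simp add: le_meet_iff le_star_commute[of _ z] join_le_iff)
qed (use assms in simp_all)

lemma star_star_star:
  assumes "x \<in> carrier L"
  shows "star (star (star x)) = star x"
  using assms by (intro le_antisym) (auto intro: star_antimono le_star_star)

text \<open>The Galois connection moves the outer star onto \<open>z\<close>, and what remains on
  the left is \<open>star (star x) \<sqinter> star y\<close>. The double star on \<open>x\<close>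
  can then be dropped: an element is disjoint from \<open>x\<close> iff it lies below
  \<open>star x\<close>, and \<open>star x\<close> equals its own double star.\<close>

lemma meet_double_star_le_iff:
  assumes "x \<in> carrier L" "y \<in> carrier L" "z \<in> carrier L"
  shows "z \<preceq> star (star (star x \<squnion> star (star y))) \<longleftrightarrow> x \<sqinter> z \<sqinter> star y = \<zero>"
proof -
  have "z \<preceq> star (star (star x \<squnion> star (star y))) \<longleftrightarrow> star (star x) \<sqinter> star y \<preceq> star z"
    using assms by (simp add: le_star_commute[of _ z] star_join star_star_star)
  also have "\<dots> \<longleftrightarrow> star (star x) \<sqinter> (star y \<sqinter> z) = \<zero>"
    using assms by (simp add: le_star_iff meet_comm[of z] meet_assoc)
  also have "\<dots> \<longleftrightarrow> x \<sqinter> (star y \<sqinter> z) = \<zero>"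
    using assms by (simp add: le_star_iff[symmetric] star_star_star)
  also have "x \<sqinter> (star y \<sqinter> z) = x \<sqinter> z \<sqinter> star y"
    using assms by (simp add: meet_assoc meet_comm[of z])
  finally show ?thesis .
qed

text \<open>The De Morgan negation is abstracted away: an element \<open>d\<close> stands for the
  dual pseudocomplement of \<open>x \<squnion> star x\<close>, and only \<open>top\<close> and
  \<open>reg\<close> are kept from it.\<close>

lemma residual_if_dense_complement:
  assumes car: "x \<in> carrier L" "y \<in> carrier L" "z \<in> carrier L" "d \<in> carrier L"
    and top: "(x \<squnion> star x) \<squnion> d = \<one>"
    and reg: "(x \<squnion> star x) \<sqinter> d \<preceq> y \<squnion> star y"
  shows "x \<sqinter> z \<preceq> y \<longleftrightarrow>
    z \<preceq> star (star (star x \<squnion> star (star y))) \<sqinter> (d \<squnion> star x \<squnion> y \<squnion> star y)"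
    (is "_ \<longleftrightarrow> z \<preceq> ?a \<sqinter> ?b")
proof
  assume le: "x \<sqinter> z \<preceq> y"
  have "x \<sqinter> z \<preceq> star (star y)"
    using car le by (meson le_star_star le_trans meet_closed star_closed)
  then have "x \<sqinter> z \<sqinter> star y = \<zero>"
    using car by (simp add: le_star_iff meet_comm[of "star y"])
  then have "z \<preceq> ?a"
    using car by (simp add: meet_double_star_le_iff)
  moreover have "z \<preceq> ?b"
  proof -
    have "z = z \<sqinter> ((x \<squnion> star x) \<squnion> d)"
      using car top by (simp add: meet_one)
    also have "\<dots> = x \<sqinter> z \<squnion> z \<sqinter> star x \<squnion> z \<sqinter> d"
      using car by (simp add: distrib meet_comm[of z x])
    finally have "z = x \<sqinter> z \<squnion> z \<sqinter> star x \<squnion> z \<sqinter> d" .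
    moreover have "x \<sqinter> z \<preceq> ?b"
      using car le by (simp add: le_joinI1 le_joinI2)
    moreover have "z \<sqinter> star x \<preceq> ?b" "z \<sqinter> d \<preceq> ?b"
      using car by (simp_all add: le_joinI1 le_joinI2 meet_le2)
    ultimately show ?thesis
      using car by (metis join_closed join_le_iff meet_closed star_closed)
  qed
  ultimately show "z \<preceq> ?a \<sqinter> ?b"
    using car by (simp add: le_meet_iff)
next
  assume "z \<preceq> ?a \<sqinter> ?b"
  with car have za: "z \<preceq> ?a" and zb: "z \<preceq> ?b"
    by (simp_all add: le_meet_iff)
  have "x \<sqinter> d \<preceq> (x \<squnion> star x) \<sqinter> d"
    using car by (simp add: meet_comm[of _ d] meet_mono_right join_ge1)
  with reg have "x \<sqinter> d \<preceq> y \<squnion> star y"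
    using car by (meson join_closed le_trans meet_closed star_closed)
  \<comment> \<open>The summand \<open>star x\<close> of \<open>?b\<close> vanishes under the meet
    with \<open>x\<close>.\<close>
  moreover have "x \<sqinter> ?b = x \<sqinter> d \<squnion> x \<sqinter> y \<squnion> x \<sqinter> star y"
    using car by (simp add: distrib meet_star join_zero)
  moreover have "x \<sqinter> y \<preceq> y \<squnion> star y" "x \<sqinter> star y \<preceq> y \<squnion> star y"
    using car by (simp_all add: le_joinI1 le_joinI2 meet_le2)
  ultimately have "x \<sqinter> ?b \<preceq> y \<squnion> star y"
    using car by (simp add: join_le_iff)
  moreover have "x \<sqinter> z \<preceq> x \<sqinter> ?b"
    using car zb by (simp add: meet_mono_right)
  ultimately have "x \<sqinter> z \<preceq> y \<squnion> star y"
    using car le_trans[of "x \<sqinter> z" "x \<sqinter> ?b" "y \<squnion> star y"] by simp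
  then have "x \<sqinter> z = x \<sqinter> z \<sqinter> (y \<squnion> star y)"
    by (simp add: lat_le_def)
  also have "\<dots> = x \<sqinter> z \<sqinter> y \<squnion> x \<sqinter> z \<sqinter> star y"
    using car by (simp add: distrib)
  \<comment> \<open>\<open>z \<preceq> ?a\<close> says exactly that
    \<open>x \<sqinter> z \<sqinter> star y\<close> is zero.\<close>
  also have "\<dots> = x \<sqinter> z \<sqinter> y"
    using car za by (simp add: meet_double_star_le_iff join_zero)
  finally show "x \<sqinter> z \<preceq> y"
    by (simp add: lat_le_def)
qed

end

section \<open>Heyting implication\<close>

context heyting_algebra
begin

lemma arrow_closed [simp]: "\<lbrakk>x \<in> carrier L; y \<in> carrier L\<rbrakk> \<Longrightarrow> arrow x y \<in> carrier L"
  using arrow_type by (meson PiE_mem)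

text \<open>The restriction matters for \<open>star_type\<close>: outside the carrier
  \<open>arrow x\<close> is \<open>undefined\<close>, but its value at \<open>\<zero>\<close> need
  not be.\<close>

lemma pseudocomplemented: "pseudocomplemented_lattice L (\<lambda>x \<in> carrier L. arrow x \<zero>)"
proof unfold_locales
  fix x assume x: "x \<in> carrier L"
  then have "x \<sqinter> arrow x \<zero> \<preceq> \<zero>"
    by (simp add: residuation le_refl)
  with x show "x \<sqinter> (\<lambda>x \<in> carrier L. arrow x \<zero>) x = \<zero>"
    by (simp add: le_zero_iff)
qed (auto simp: residuation[symmetric] le_refl)

lemma arrow_unique:
  assumes "x \<in> carrier L" "y \<in> carrier L" "w \<in> carrier L"
    and "\<And>z. z \<in> carrier L \<Longrightarrow> x \<sqinter> z \<preceq> y \<longleftrightarrow> z \<preceq> w"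
  shows "arrow x y = w"
  using assms by (intro eq_if_same_lower) (simp_all add: residuation[symmetric])

end

lemma (in de_morgan_algebra) neg_closed [simp]: "x \<in> carrier L \<Longrightarrow> x\<^sup>\<prime> \<in> carrier L"
  using neg_type by (meson PiE_mem)

section \<open>Structure determined by the fields that both translations copy\<close>

lemma de_morgan_algebra_dmh: "de_morgan_algebra (dmh A) \<longleftrightarrow> de_morgan_algebra A"
  by (simp add: de_morgan_algebra_def bounded_distrib_lattice_def de_morgan_algebra_axioms_def dmh_def)

lemma de_morgan_algebra_dmp: "de_morgan_algebra (dmp A) \<longleftrightarrow> de_morgan_algebra A"
  by (simp add: de_morgan_algebra_def bounded_distrib_lattice_def de_morgan_algebra_axioms_def dmp_def)

lemma lat_le_dmh: "lat_le (dmh A) = lat_le A"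
  by (simp add: fun_eq_iff lat_le_def dmh_def)

lemma lat_le_dmp: "lat_le (dmp A) = lat_le A"
  by (simp add: fun_eq_iff lat_le_def dmp_def)

section \<open>From RDMP to RDMH and back\<close>

context
  fixes A :: "'a dmp_algebra" (structure)
  assumes A: "A \<in> RDMP"
begin

interpretation de_morgan_algebra A
  using A by (simp add: RDMP_def)

interpretation pseudocomplemented_lattice A "pcomp A"
  using A by (simp add: RDMP_def)

lemma dmh_imp_closed:
  assumes "x \<in> carrier A" "y \<in> carrier A"
  shows "dmh_imp A x y \<in> carrier A"
  using assms by (simp add: dmh_imp_def)

lemma dmh_imp_residual:
  assumes "x \<in> carrier A" "y \<in> carrier A" "z \<in> carrier A"
  shows "x \<sqinter> z \<preceq> y \<longleftrightarrow> z \<preceq> dmh_imp A x y"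
  unfolding dmh_imp_def
proof (rule residual_if_dense_complement)
  let ?w = "x \<squnion> x\<^sup>\<star>"
  \<comment> \<open>Here \<open>d\<close> is
    \<open>?w\<^sup>\<prime>\<^sup>\<star>\<^sup>\<prime>\<close>; its join with \<open>?w\<close>
    is the De Morgan dual of the \<open>meet_star\<close> law at
    \<open>?w\<^sup>\<prime>\<close>.\<close>
  have "(?w\<^sup>\<prime> \<sqinter> ?w\<^sup>\<prime>\<^sup>\<star>)\<^sup>\<prime> = \<zero>\<^sup>\<prime>"
    using assms by (subst meet_star) simp_all
  moreover have "(?w\<^sup>\<prime> \<sqinter> ?w\<^sup>\<prime>\<^sup>\<star>)\<^sup>\<prime> = ?w \<squnion> ?w\<^sup>\<prime>\<^sup>\<star>\<^sup>\<prime>"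
    using assms by (subst neg_meet) (simp_all add: neg_neg)
  ultimately show "?w \<squnion> ?w\<^sup>\<prime>\<^sup>\<star>\<^sup>\<prime> = \<one>"
    by (simp add: neg_zero)
  \<comment> \<open>This is the regularity identity at \<open>?w\<close> and \<open>y\<close>, read
    as an inequality.\<close>
  show "?w \<sqinter> ?w\<^sup>\<prime>\<^sup>\<star>\<^sup>\<prime> \<preceq> y \<squnion> y\<^sup>\<star>"
    using A assms by (subst le_iff_join) (simp_all add: RDMP_def regular_def)
qed (use assms in simp_all)

text \<open>An element lies below either side iff it is disjoint from \<open>x\<close>. This carries
  regularity over to \<open>dmh A\<close> and recovers \<open>pcomp A\<close> from it.\<close>

lemma dmh_imp_zero:
  assumes "x \<in> carrier A"
  shows "dmh_imp A x \<zero> = x\<^sup>\<star>"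
  using assms
  by (intro eq_if_same_lower)
    (simp_all add: dmh_imp_closed dmh_imp_residual[symmetric] le_zero_iff le_star_iff)

lemma dmh_in_RDMH: "dmh A \<in> RDMH"
proof -
  have "de_morgan_algebra (dmh A)"
    by (simp add: de_morgan_algebra_dmh de_morgan_algebra_axioms)
  moreover from this have "heyting_algebra (dmh A) (imp (dmh A))"
    by (intro heyting_algebra.intro de_morgan_algebra.axioms(1) heyting_algebra_axioms.intro,
        unfold lat_le_dmh)
      (auto simp: dmh_def dmh_imp_closed dmh_imp_residual)
  moreover have "regular (dmh A) (\<lambda>x. x \<rightarrow>\<^bsub>dmh A\<^esub> \<zero>\<^bsub>dmh A\<^esub>)"
    using A by (simp add: regular_def dmh_def dmh_imp_zero RDMP_def)
  ultimately show ?thesis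
    by (simp add: RDMH_def)
qed

lemma dmp_dmh: "dmp (dmh A) = A"
proof -
  \<comment> \<open>Only the \<open>pcomp\<close> field is rebuilt; extensionality settles its
    values outside the carrier.\<close>
  have "(\<lambda>x \<in> carrier A. dmh_imp A x \<zero>) = pcomp A"
    using star_type by (intro extensionalityI) (auto simp: dmh_imp_zero PiE_iff)
  then show ?thesis
    by (simp add: dmp_def dmh_def cong: restrict_cong)
qed

end

section \<open>From RDMH to RDMP and back\<close>

context
  fixes A :: "'a dmh_algebra" (structure)
  assumes A: "A \<in> RDMH"
begin

interpretation de_morgan_algebra A
  using A by (simp add: RDMH_def)

interpretation heyting_algebra A "imp A"
  using A by (simp add: RDMH_def)

lemma dmp_in_RDMP: "dmp A \<in> RDMP"
proof -
  have "de_morgan_algebra (dmp A)"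
    by (simp add: de_morgan_algebra_dmp de_morgan_algebra_axioms)
  moreover from this have "pseudocomplemented_lattice (dmp A) (pcomp (dmp A))"
    using pseudocomplemented_lattice.star_type[OF pseudocomplemented]
      pseudocomplemented_lattice.meet_star[OF pseudocomplemented]
      pseudocomplemented_lattice.star_greatest[OF pseudocomplemented]
    by (intro pseudocomplemented_lattice.intro de_morgan_algebra.axioms(1)
        pseudocomplemented_lattice_axioms.intro, unfold lat_le_dmp)
      (simp_all add: dmp_def)
  moreover have "regular (dmp A) (pcomp (dmp A))"
    using A by (simp add: regular_def dmp_def RDMH_def)
  ultimately show ?thesis
    by (simp add: RDMP_def)
qed

lemma dmh_dmp: "dmh (dmp A) = A"
proof -
  have car: "carrier (dmp A) = carrier A" and meet: "meet (dmp A) = meet A"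
    by (simp_all add: dmp_def)
  \<comment> \<open>Since \<open>dmp A\<close> is in \<open>RDMP\<close>, the term
    \<open>dmh_imp (dmp A) x y\<close> satisfies the residuation law. That law refers only to the
    carrier and the meet, which \<open>A\<close> shares, so it determines
    \<open>imp A x y\<close>.\<close>
  have "imp A x y = dmh_imp (dmp A) x y" if "x \<in> carrier A" "y \<in> carrier A" for x y
    using that dmh_imp_closed[OF dmp_in_RDMP] dmh_imp_residual[OF dmp_in_RDMP]
    by (intro arrow_unique) (simp_all add: car meet lat_le_dmp)
  then have "(\<lambda>x \<in> carrier A. \<lambda>y \<in> carrier A. dmh_imp (dmp A) x y)
      = (\<lambda>x \<in> carrier A. \<lambda>y \<in> carrier A. imp A x y)"
    by (auto simp: restrict_def fun_eq_iff)
  \<comment> \<open>Both restrictions are harmless because \<open>arrow_type\<close> makes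
    \<open>imp A\<close> extensional in each argument.\<close>
  also have "\<dots> = imp A"
    using arrow_type by (auto simp: restrict_def fun_eq_iff PiE_iff extensional_def)
  finally show ?thesis
    unfolding dmh_def by (simp add: dmp_def)
qed

end

theorem corollary2p8:
  shows "(\<forall>A \<in> (RDMP :: 'a dmp_algebra set). dmh A \<in> RDMH)
    \<and> (\<forall>A \<in> (RDMH :: 'a dmh_algebra set). dmp A \<in> RDMP)
    \<and> (\<forall>A \<in> (RDMP :: 'a dmp_algebra set). dmp (dmh A) = A)
    \<and> (\<forall>A \<in> (RDMH :: 'a dmh_algebra set). dmh (dmp A) = A)"
  by (simp add: dmh_in_RDMH dmp_in_RDMP dmp_dmh dmh_dmp)

end
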